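(* There is no positive number $M$ such that $$\|f(A_1,B_1)-f(A_2,B_2)\|\le M\,\|f\|_{L^\infty(\mathbb{R}^2)}\left(\|A_1-A_2\|+\|B_1-B_2\|\right)$$ for all bounded functions $f$ on $\mathbb{R}^2$ with Fourier transform supported in $[-1,1]^2$ and for all finite rank self-adjoint operators $A_1,A_2,B_1,B_2$ on Hilbert space.
   Context: $\|\cdot\|$ applied to operators is the operator norm. The operators are not assumed to commute. The Fourier transform is in the sense of tempered distributions, normalized by $(\mathcal{F}f)(\xi)=\int f(x)e^{-i(x,\xi)}\,dx$; a bounded function with compactly supported Fourier transform is identified with its smooth representative. For self-adjoint operators $A,B$ with spectral measures $E_A,E_B$, $f(A,B)=\iint f(x,y)\,dE_A(x)\,dE_B(y)$ (double operator integral); for finite rank $A$ and $B$ this is the finite sum $$f(A,B)=\sum_{\lambda\in\sigma(A)}\sum_{\mu\in\sigma(B)}f(\lambda,\mu)\,E_A(\{\lambda\})\,E_B(\{\mu\}).$$ *)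

theory Defs
  imports "HOL-Analysis.Analysis" "HOL-Probability.Essential_Supremum"
begin

section \<open>Complex Hilbert spaces\<close>

text \<open>
  The inner product is linear in its first argument. The real scalar multiplication, the norm and
  the topology are those of the underlying real Banach space; the axioms tie them to the complex
  structure. In particular \<open>cinner_self\<close> contains positive definiteness.
\<close>

class complex_hilbert_space = banach +
  fixes scaleC :: "complex \<Rightarrow> 'a \<Rightarrow> 'a" (infixr \<open>*\<^sub>C\<close> 75)
    and cinner :: "'a \<Rightarrow> 'a \<Rightarrow> complex"
  assumes scaleC_add_right: "c *\<^sub>C (x + y) = c *\<^sub>C x + c *\<^sub>C y"
    and scaleC_add_left: "(c + d) *\<^sub>C x = c *\<^sub>C x + d *\<^sub>C x"
    and scaleC_scaleC: "c *\<^sub>C (d *\<^sub>C x) = (c * d) *\<^sub>C x"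
    and scaleC_of_real: "complex_of_real r *\<^sub>C x = r *\<^sub>R x"
    and cinner_commute: "cinner x y = cnj (cinner y x)"
    and cinner_add_left: "cinner (x + y) z = cinner x z + cinner y z"
    and cinner_scaleC_left: "cinner (c *\<^sub>C x) y = c * cinner x y"
    and cinner_self: "cinner x x = complex_of_real ((norm x)\<^sup>2)"

global_interpretation complex_vector:
  vector_space "scaleC :: complex \<Rightarrow> 'a \<Rightarrow> 'a :: complex_hilbert_space"
proof unfold_locales
  fix x :: 'a
  show "1 *\<^sub>C x = x"
    using scaleC_of_real[of 1 x] by simp
qed (simp_all add: scaleC_add_right scaleC_add_left scaleC_scaleC)

definition infinite_dimensional :: "'a::complex_hilbert_space itself \<Rightarrow> bool" where
  "infinite_dimensional _ \<longleftrightarrow> \<not> (\<exists>S :: 'a set. finite S \<and> complex_vector.span S = UNIV)"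

lemma norm_scaleC: "norm (c *\<^sub>C x) = cmod c * norm x" for x :: "'a::complex_hilbert_space"
proof -
  have "complex_of_real ((norm (c *\<^sub>C x))\<^sup>2) = cinner (c *\<^sub>C x) (c *\<^sub>C x)"
    by (simp add: cinner_self)
  also have "\<dots> = c * cnj c * cinner x x"
    using cinner_commute[of x "c *\<^sub>C x"] cinner_commute[of x x]
    by (simp add: cinner_scaleC_left)
  also have "\<dots> = complex_of_real ((cmod c * norm x)\<^sup>2)"
    by (simp add: cinner_self complex_norm_square[symmetric] power_mult_distrib)
  finally have "(norm (c *\<^sub>C x))\<^sup>2 = (cmod c * norm x)\<^sup>2"
    using of_real_eq_iff by blast
  then show ?thesis
    by (simp add: power2_eq_iff_nonneg)
qed


section \<open>Finite rank self-adjoint operators\<close>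

text \<open>
  Operators are elements of the library type of bounded real-linear maps, whose norm is the
  operator norm. The operators of interest satisfy \<open>selfadjoint\<close>, which for everywhere defined
  maps entails complex linearity.
\<close>

definition selfadjoint :: "('a::complex_hilbert_space \<Rightarrow>\<^sub>L 'a) \<Rightarrow> bool" where
  "selfadjoint A \<longleftrightarrow> (\<forall>x y. cinner (A x) y = cinner x (A y))"

definition finite_rank :: "('a::complex_hilbert_space \<Rightarrow>\<^sub>L 'a) \<Rightarrow> bool" where
  "finite_rank A \<longleftrightarrow> (\<exists>S. finite S \<and> range A \<subseteq> complex_vector.span S)"

text \<open>
  The spectrum of a self-adjoint operator is real, so only real spectral values are recorded. The
  inverse \<open>R\<close> of a complex linear map is automatically complex linear.
\<close>

definition spectrum :: "('a::complex_hilbert_space \<Rightarrow>\<^sub>L 'a) \<Rightarrow> real set" where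
  "spectrum A = {s. \<not> (\<exists>R. (A - s *\<^sub>R id_blinfun) o\<^sub>L R = id_blinfun \<and>
                             R o\<^sub>L (A - s *\<^sub>R id_blinfun) = id_blinfun)}"

text \<open>
  \<open>spectral_proj A s\<close> is \<open>E\<^sub>A({s})\<close> for self-adjoint \<open>A\<close>: the orthogonal projection
  (self-adjoint idempotent) whose range is the eigenspace \<open>ker (A - s)\<close>.
\<close>

definition spectral_proj :: "('a::complex_hilbert_space \<Rightarrow>\<^sub>L 'a) \<Rightarrow> real \<Rightarrow> 'a \<Rightarrow>\<^sub>L 'a" where
  "spectral_proj A s =
     (THE P. P o\<^sub>L P = P \<and> selfadjoint P \<and> range P = {x. A x = s *\<^sub>R x})"

lift_definition scaleC_op ::
  "complex \<Rightarrow> ('a::complex_hilbert_space \<Rightarrow>\<^sub>L 'a) \<Rightarrow> 'a \<Rightarrow>\<^sub>L 'a" is "\<lambda>c T x. c *\<^sub>C T x"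
proof -
  fix c :: complex and T :: "'a \<Rightarrow> 'a"
  assume "bounded_linear T"
  moreover have "bounded_linear (\<lambda>x :: 'a. c *\<^sub>C x)"
    by (rule bounded_linear_intro[where K = "cmod c"])
      (simp_all add: scaleC_add_right norm_scaleC mult.commute scaleC_scaleC
        flip: scaleC_of_real)
  ultimately show "bounded_linear (\<lambda>x. c *\<^sub>C T x)"
    by (rule bounded_linear_compose[rotated])
qed

text \<open>
  The double operator integral \<open>f(A,B)\<close> for finite rank self-adjoint \<open>A\<close>, \<open>B\<close>, whose spectra
  are finite.
\<close>

definition op_fun ::
  "(real \<times> real \<Rightarrow> complex) \<Rightarrow> ('a::complex_hilbert_space \<Rightarrow>\<^sub>L 'a) \<Rightarrow> ('a \<Rightarrow>\<^sub>L 'a) \<Rightarrow> 'a \<Rightarrow>\<^sub>L 'a" where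
  "op_fun f A B = (\<Sum>s\<in>spectrum A. \<Sum>t\<in>spectrum B.
     scaleC_op (f (s, t)) (spectral_proj A s o\<^sub>L spectral_proj B t))"


section \<open>Fourier transforms of bounded functions as tempered distributions\<close>

text \<open>\<open>iter_deriv [v\<^sub>1, \<dots>, v\<^sub>k] f\<close> is the iterated directional derivative along \<open>v\<^sub>k\<close>, \dots, \<open>v\<^sub>1\<close>.\<close>

primrec iter_deriv ::
  "'a::real_normed_vector list \<Rightarrow> ('a \<Rightarrow> 'b::real_normed_vector) \<Rightarrow> 'a \<Rightarrow> 'b" where
  "iter_deriv [] f = f"
| "iter_deriv (v # vs) f = (\<lambda>x. frechet_derivative (iter_deriv vs f) (at x) v)"

definition smooth :: "('a::real_normed_vector \<Rightarrow> 'b::real_normed_vector) \<Rightarrow> bool" where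
  "smooth f \<longleftrightarrow> (\<forall>vs x. iter_deriv vs f differentiable (at x))"

definition schwartz :: "('a::euclidean_space \<Rightarrow> complex) \<Rightarrow> bool" where
  "schwartz \<phi> \<longleftrightarrow> smooth \<phi> \<and>
     (\<forall>k vs. \<exists>C. \<forall>x. norm x ^ k * cmod (iter_deriv vs \<phi> x) \<le> C)"

definition fourier :: "('a::euclidean_space \<Rightarrow> complex) \<Rightarrow> 'a \<Rightarrow> complex" where
  "fourier \<phi> \<xi> = (LINT x|lborel. \<phi> x * exp (- \<i> * complex_of_real (x \<bullet> \<xi>)))"

text \<open>
  The Fourier transform of a bounded function \<open>f\<close>, as a functional on Schwartz functions:
  \<open>\<langle>F f, \<phi>\<rangle> = \<langle>f, F \<phi>\<rangle>\<close>.
\<close>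

definition fourier_distr ::
  "('a::euclidean_space \<Rightarrow> complex) \<Rightarrow> ('a \<Rightarrow> complex) \<Rightarrow> complex" where
  "fourier_distr f \<phi> = (LINT \<xi>|lborel. f \<xi> * fourier \<phi> \<xi>)"

definition fun_support :: "('a::topological_space \<Rightarrow> complex) \<Rightarrow> 'a set" where
  "fun_support \<phi> = closure {x. \<phi> x \<noteq> 0}"

text \<open>
  The complement of the largest open set on which the distribution vanishes, i.e. on all test
  functions supported in it. Compactly supported smooth functions are exactly the compactly
  supported Schwartz functions.
\<close>

definition distr_support :: "(('a::euclidean_space \<Rightarrow> complex) \<Rightarrow> complex) \<Rightarrow> 'a set" where
  "distr_support u = - \<Union>{U. open U \<and>
     (\<forall>\<phi>. schwartz \<phi> \<and> compact (fun_support \<phi>) \<and> fun_support \<phi> \<subseteq> U \<longrightarrow> u \<phi> = 0)}"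

definition Linf_norm :: "('a::euclidean_space \<Rightarrow> complex) \<Rightarrow> real" where
  "Linf_norm f = real_of_ereal (esssup lborel (\<lambda>x. ereal (cmod (f x))))"

end

theory Submission
  imports Defs "HOL-Complex_Analysis.Complex_Analysis" "HOL-Probability.Sinc_Integral"
begin

text \<open>
  The double operator integral \<open>f(A,B)\<close> is not even bounded by a constant times the supremum of
  \<open>f\<close>, and a suitable shift of \<open>A\<close> turns this into the failure of the Lipschitz estimate.

  Let \<open>A\<close> and \<open>B\<close> have simple nonzero eigenvalues \<open>\<lambda>\<^sub>i\<close>, \<open>\<mu>\<^sub>k\<close> (\<open>i, k < n\<close>) with orthonormal
  eigenvectors \<open>e\<^sub>i\<close>, \<open>h\<^sub>k\<close>. If \<open>f\<close> vanishes on the coordinate axes, then \<open>f(A,B)\<close> is, in these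
  bases, the Schur product of the matrix \<open>f(\<lambda>\<^sub>i, \<mu>\<^sub>k)\<close> with the unitary matrix \<open>\<langle>h\<^sub>k, e\<^sub>i\<rangle>\<close>
  (lemma \<open>op_fun_diag_op\<close>). Let \<open>h\<close> be the discrete Fourier transform of \<open>e\<close>, so that all entries
  of the unitary matrix have modulus \<open>1 / sqrt n\<close>. If the values of \<open>f\<close> are the conjugate phases
  of these entries, then the Schur product has all entries \<open>1 / sqrt n\<close> and norm at least \<open>sqrt n\<close>
  (lemma \<open>schur_multiplier_lower_bound\<close>).

  A function \<open>f\<close> with these values, with spectrum in \<open>[-1,1]\<^sup>2\<close> and bounded independently of \<open>n\<close>, is
  obtained by interpolation with \<open>\<phi>(x) = (sin (x / 2) / (x / 2))\<^sup>2\<close>: put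
  \<open>f(x,y) = \<Sum> a\<^sub>i\<^sub>k \<phi>(x - \<lambda>\<^sub>i) \<phi>(y - \<lambda>\<^sub>k)\<close> with \<open>\<lambda>\<^sub>i = \<mu>\<^sub>i = 4 \<pi> (i + 1)\<close>. Boundedness holds since
  \<open>\<phi>\<close> decays quadratically (lemma \<open>interpolant_bound\<close>). The Fourier transform of the integrable
  function \<open>\<phi>\<close> vanishes outside \<open>[-1,1]\<close> by shifting the contour in the complex plane
  (lemma \<open>fourier_fejer\<close>), and the multiplication formula carries this over to the distribution
  (lemma \<open>distr_support_interpolant\<close>).

  Finally \<open>\<phi>\<close> vanishes at all nonzero multiples of \<open>2 \<pi>\<close>, so \<open>f\<close> vanishes at all the points
  \<open>(\<lambda>\<^sub>i + 2 \<pi>, y)\<close>. Moving every nonzero eigenvalue of \<open>A\<close> by \<open>2 \<pi>\<close> thus changes \<open>A\<close> by an operator of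
  norm at most \<open>2 \<pi>\<close>, but changes \<open>f(A,B)\<close> from an operator of norm at least \<open>sqrt n\<close> to \<open>0\<close>.
  Since \<open>n\<close> is arbitrary, no Lipschitz constant exists.
\<close>

section \<open>Orthonormal families in complex Hilbert spaces\<close>

lemma cinner_add_right: "cinner x (y + z) = cinner x y + cinner x z"
  by (metis cinner_add_left cinner_commute complex_cnj_add)

lemma cinner_scaleC_right: "cinner x (c *\<^sub>C y) = cnj c * cinner x y"
  by (metis cinner_scaleC_left cinner_commute complex_cnj_mult)

lemma cinner_zero_left [simp]: "cinner 0 y = 0"
  using cinner_add_left[of 0 0 y] by simp

lemma cinner_zero_right [simp]: "cinner x 0 = 0"
  using cinner_add_right[of x 0 0] by simp

lemma cinner_diff_left: "cinner (x - y) z = cinner x z - cinner y z"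
  using cinner_add_left[of "x - y" y z] by simp

lemma cinner_diff_right: "cinner x (y - z) = cinner x y - cinner x z"
  using cinner_add_right[of x "y - z" z] by simp

lemma cinner_sum_left: "cinner (sum f S) y = (\<Sum>i\<in>S. cinner (f i) y)"
  by (induction S rule: infinite_finite_induct) (simp_all add: cinner_add_left)

lemma cinner_sum_right: "cinner x (sum f S) = (\<Sum>i\<in>S. cinner x (f i))"
  by (induction S rule: infinite_finite_induct) (simp_all add: cinner_add_right)

lemma cinner_eq_zero_iff [simp]: "cinner x x = 0 \<longleftrightarrow> x = 0"
  by (simp add: cinner_self)

lemma norm_eq_sqrt_cinner: "norm x = sqrt (Re (cinner x x))"
  by (simp add: cinner_self)

text \<open>
  Expand the squared norm of \<open>\<parallel>y\<parallel>\<^sup>2 x - \<langle>x, y\<rangle> y\<close>, a multiple of the component of \<open>x\<close>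
  orthogonal to \<open>y\<close>.
\<close>

lemma cauchy_schwarz: "cmod (cinner x y) \<le> norm x * norm y"
proof (cases "y = 0")
  case False
  define c where "c = cinner x y"
  define r where "r = complex_of_real ((norm y)\<^sup>2)"
  have yy: "cinner y y = r" and yx: "cinner y x = cnj c"
    by (simp_all add: r_def c_def cinner_self flip: cinner_commute)
  have cc: "c * cnj c = complex_of_real ((cmod c)\<^sup>2)"
    by (rule complex_norm_square[symmetric])
  have "cinner (r *\<^sub>C x - c *\<^sub>C y) (r *\<^sub>C x - c *\<^sub>C y)
      = r * (r * cinner x x - c * cnj c)"
    by (simp add: cinner_diff_left cinner_diff_right cinner_scaleC_left cinner_scaleC_right yy yx
        flip: c_def) (simp add: r_def algebra_simps)
  also have "\<dots> = complex_of_real ((norm y)\<^sup>2 * ((norm y)\<^sup>2 * (norm x)\<^sup>2 - (cmod c)\<^sup>2))"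
    unfolding cc by (simp add: r_def cinner_self)
  finally have "(norm (r *\<^sub>C x - c *\<^sub>C y))\<^sup>2 = (norm y)\<^sup>2 * ((norm y)\<^sup>2 * (norm x)\<^sup>2 - (cmod c)\<^sup>2)"
    unfolding cinner_self of_real_eq_iff .
  then have "0 \<le> (norm y)\<^sup>2 * ((norm y)\<^sup>2 * (norm x)\<^sup>2 - (cmod c)\<^sup>2)"
    by (metis zero_le_power2)
  with False have "(cmod c)\<^sup>2 \<le> (norm x * norm y)\<^sup>2"
    by (simp add: zero_le_mult_iff power_mult_distrib mult.commute)
  then show ?thesis
    unfolding c_def by (rule power2_le_imp_le) simp
qed simp

definition orthonormal :: "nat \<Rightarrow> (nat \<Rightarrow> 'a::complex_hilbert_space) \<Rightarrow> bool" where
  "orthonormal n e \<longleftrightarrow> (\<forall>i<n. \<forall>j<n. cinner (e i) (e j) = (if i = j then 1 else 0))"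

lemma orthonormalD:
  "orthonormal n e \<Longrightarrow> i < n \<Longrightarrow> j < n \<Longrightarrow> cinner (e i) (e j) = (if i = j then 1 else 0)"
  by (simp add: orthonormal_def)

lemma cinner_orthonormal_sum:
  assumes "orthonormal n e" "j < n"
  shows "cinner (\<Sum>i<n. c i *\<^sub>C e i) (e j) = c j"
proof -
  have "cinner (\<Sum>i<n. c i *\<^sub>C e i) (e j) = (\<Sum>i<n. if i = j then c i else 0)"
    unfolding cinner_sum_left
    by (intro sum.cong) (use assms in \<open>auto simp: cinner_scaleC_left orthonormalD\<close>)
  with assms(2) show ?thesis by (simp add: sum.delta')
qed

lemma norm_orthonormal_sum:
  assumes "orthonormal n e"
  shows "norm (\<Sum>i<n. c i *\<^sub>C e i) = sqrt (\<Sum>i<n. (cmod (c i))\<^sup>2)"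
proof -
  have "cinner (\<Sum>i<n. c i *\<^sub>C e i) (\<Sum>i<n. c i *\<^sub>C e i) = (\<Sum>i<n. cnj (c i) * c i)"
    by (subst cinner_sum_right)
      (simp add: cinner_scaleC_right cinner_orthonormal_sum[OF assms])
  also have "\<dots> = complex_of_real (\<Sum>i<n. (cmod (c i))\<^sup>2)"
    unfolding of_real_sum complex_norm_square by (simp add: mult.commute)
  finally show ?thesis
    unfolding norm_eq_sqrt_cinner by simp
qed

text \<open>
  Gram--Schmidt: no finite set spans the space, so some vector has a nonzero component orthogonal
  to the vectors found so far.
\<close>

lemma orthonormal_exists:
  assumes "infinite_dimensional TYPE('a::complex_hilbert_space)"
  shows "\<exists>e :: nat \<Rightarrow> 'a. orthonormal n e"
proof (induction n)
  case 0
  show ?case by (simp add: orthonormal_def)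
next
  case (Suc n)
  then obtain e :: "nat \<Rightarrow> 'a" where e: "orthonormal n e" by blast
  obtain v where v: "v \<notin> complex_vector.span (e ` {..<n})"
    using assms unfolding infinite_dimensional_def by blast
  define w where "w = v - (\<Sum>i<n. cinner v (e i) *\<^sub>C e i)"
  have "(\<Sum>i<n. cinner v (e i) *\<^sub>C e i) \<in> complex_vector.span (e ` {..<n})"
    by (intro complex_vector.span_sum complex_vector.span_scale complex_vector.span_base) auto
  with v have w: "w \<noteq> 0"
    unfolding w_def by auto
  have we: "cinner w (e j) = 0" if "j < n" for j
    using that by (simp add: w_def cinner_diff_left cinner_orthonormal_sum[OF e])
  have ew: "cinner (e j) w = 0" if "j < n" for j
    using we[OF that] by (metis cinner_commute complex_cnj_zero)
  define u where "u = complex_of_real (1 / norm w) *\<^sub>C w"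
  have "cinner u u = 1"
    using w by (simp add: u_def cinner_scaleC_left cinner_scaleC_right cinner_self[of w]
        power2_eq_square)
  moreover have "cinner u (e j) = 0" "cinner (e j) u = 0" if "j < n" for j
    using that by (simp_all add: u_def cinner_scaleC_left cinner_scaleC_right we ew)
  ultimately have "orthonormal (Suc n) (e(n := u))"
    using e unfolding orthonormal_def by (auto simp: less_Suc_eq)
  then show ?case by blast
qed

section \<open>Diagonal operators of finite rank\<close>

lift_definition line_proj :: "'a::complex_hilbert_space \<Rightarrow> 'a \<Rightarrow>\<^sub>L 'a" is
  "\<lambda>e x. cinner x e *\<^sub>C e"
proof (rule bounded_linear_intro)
  fix e x y :: 'a and r :: real
  show "cinner (x + y) e *\<^sub>C e = cinner x e *\<^sub>C e + cinner y e *\<^sub>C e"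
    by (simp add: cinner_add_left scaleC_add_left)
  show "cinner (r *\<^sub>R x) e *\<^sub>C e = r *\<^sub>R (cinner x e *\<^sub>C e)"
    by (simp add: cinner_scaleC_left scaleC_scaleC flip: scaleC_of_real)
  show "norm (cinner x e *\<^sub>C e) \<le> norm x * (norm e * norm e)"
    using mult_right_mono[OF cauchy_schwarz[of x e], of "norm e"]
    by (simp add: norm_scaleC mult.assoc)
qed

definition diag_op :: "nat \<Rightarrow> (nat \<Rightarrow> 'a::complex_hilbert_space) \<Rightarrow> (nat \<Rightarrow> real) \<Rightarrow> 'a \<Rightarrow>\<^sub>L 'a" where
  "diag_op n e l = (\<Sum>i<n. l i *\<^sub>R line_proj (e i))"

lemma diag_op_apply:
  "diag_op n e l x = (\<Sum>i<n. (complex_of_real (l i) * cinner x (e i)) *\<^sub>C e i)"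
  by (simp add: diag_op_def blinfun.sum_left blinfun.scaleR_left line_proj.rep_eq scaleC_scaleC
      flip: scaleC_of_real)

lemma cinner_diag_op:
  assumes "orthonormal n e" "j < n"
  shows "cinner (diag_op n e l x) (e j) = complex_of_real (l j) * cinner x (e j)"
  unfolding diag_op_apply by (rule cinner_orthonormal_sum[OF assms])

lemma diag_op_basis:
  assumes "orthonormal n e" "j < n"
  shows "diag_op n e l (e j) = l j *\<^sub>R e j"
proof -
  have "diag_op n e l (e j) = (\<Sum>i<n. if i = j then l j *\<^sub>R e j else 0)"
    unfolding diag_op_apply
    by (intro sum.cong) (use assms in \<open>auto simp: orthonormalD scaleC_of_real\<close>)
  with assms(2) show ?thesis by (simp add: sum.delta')
qed

lemma diag_op_diag_op:
  assumes "orthonormal n e"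
  shows "diag_op n e l (diag_op n e m x) = diag_op n e (\<lambda>i. l i * m i) x"
  unfolding diag_op_apply[of n e l] diag_op_apply[of n e "\<lambda>i. l i * m i"]
  by (intro sum.cong) (simp_all add: cinner_diag_op[OF assms] mult.assoc)

lemma selfadjoint_diag_op: "selfadjoint (diag_op n e l)"
  unfolding selfadjoint_def diag_op_apply
  by (auto simp: cinner_sum_left cinner_sum_right cinner_scaleC_left cinner_scaleC_right
      cinner_commute[of "e _"] intro!: sum.cong)

lemma finite_rank_diag_op: "finite_rank (diag_op n e l)"
  unfolding finite_rank_def
proof (intro exI conjI subsetI)
  show "finite (e ` {..<n})" by simp
  fix y assume "y \<in> range (diag_op n e l)"
  then obtain x where y: "y = diag_op n e l x" by blast
  show "y \<in> complex_vector.span (e ` {..<n})"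
    unfolding y diag_op_apply
    by (intro complex_vector.span_sum complex_vector.span_scale complex_vector.span_base) auto
qed

text \<open>
  The operator with constant eigenvalue \<open>c\<close> is \<open>c\<close> times an orthogonal projection. For a
  projection \<open>P\<close>, self-adjointness gives \<open>\<parallel>P x\<parallel>\<^sup>2 = \<langle>P x, x\<rangle>\<close>, and Cauchy--Schwarz
  bounds this by \<open>\<parallel>P x\<parallel> \<parallel>x\<parallel>\<close>.
\<close>

lemma norm_diag_op_const:
  assumes e: "orthonormal n e"
  shows "norm (diag_op n e (\<lambda>_. c)) \<le> \<bar>c\<bar>"
proof (rule norm_blinfun_bound)
  fix x
  define P where "P = diag_op n e (\<lambda>_. 1) x"
  have cP: "diag_op n e (\<lambda>_. c) x = complex_of_real c *\<^sub>C P"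
    unfolding P_def diag_op_apply by (simp add: complex_vector.scale_sum_right)
  have "cinner P (x - P) = 0"
  proof -
    have "cinner P (x - P) = cinner x (diag_op n e (\<lambda>_. 1) (x - P))"
      using selfadjoint_diag_op[of n e "\<lambda>_. 1"] unfolding P_def selfadjoint_def by blast
    also have "diag_op n e (\<lambda>_. 1) (x - P) = 0"
      by (simp add: P_def blinfun.diff_right diag_op_diag_op[OF e])
    finally show ?thesis by simp
  qed
  then have PP: "cinner P P = cinner P x"
    by (simp add: cinner_diff_right)
  have "(norm P)\<^sup>2 = cmod (cinner P P)"
    by (simp add: cinner_self norm_power)
  also have "\<dots> \<le> norm P * norm x"
    unfolding PP by (rule cauchy_schwarz)
  finally have "norm P \<le> norm x"
    by (cases "P = 0") (auto simp: power2_eq_square)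
  then show "norm (diag_op n e (\<lambda>_. c) x) \<le> \<bar>c\<bar> * norm x"
    by (simp add: cP norm_scaleC mult_left_mono)
qed simp

lemma eigenvalue_in_spectrum:
  assumes "blinfun_apply A x = s *\<^sub>R x" "x \<noteq> 0"
  shows "s \<in> spectrum A"
  unfolding spectrum_def
proof (clarify)
  fix R assume R: "R o\<^sub>L (A - s *\<^sub>R id_blinfun) = id_blinfun"
  have "(A - s *\<^sub>R id_blinfun) x = 0"
    using assms(1) by (simp add: blinfun.diff_left blinfun.scaleR_left)
  then have "(R o\<^sub>L (A - s *\<^sub>R id_blinfun)) x = 0" by simp
  then show False
    using assms(2) unfolding R by simp
qed

text \<open>
  Away from \<open>0\<close> and the \<open>l i\<close> the resolvent is explicit: it is \<open>1 / (l i - s)\<close> on \<open>e i\<close> and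
  \<open>- 1 / s\<close> on the orthogonal complement. As \<open>diag_op\<close> vanishes on that complement, this is
  \<open>- 1 / s\<close> times the identity plus a diagonal correction \<open>m\<close>.
\<close>

lemma spectrum_diag_op_subset:
  assumes e: "orthonormal n e"
  shows "spectrum (diag_op n e l) \<subseteq> insert 0 (l ` {..<n})"
proof
  fix s assume s: "s \<in> spectrum (diag_op n e l)"
  show "s \<in> insert 0 (l ` {..<n})"
  proof (rule ccontr)
    assume *: "s \<notin> insert 0 (l ` {..<n})"
    define m where "m = (\<lambda>i. 1 / (l i - s) + 1 / s)"
    define R where "R = diag_op n e m - (1 / s) *\<^sub>R id_blinfun"
    have 0: "diag_op n e (\<lambda>i. l i * m i) x - (1 / s) *\<^sub>R diag_op n e l x - s *\<^sub>R diag_op n e m x = 0"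
      for x
    proof -
      have "diag_op n e (\<lambda>i. l i * m i) x - (1 / s) *\<^sub>R diag_op n e l x - s *\<^sub>R diag_op n e m x
          = (\<Sum>i<n. (l i * m i - l i / s - s * m i) *\<^sub>R line_proj (e i) x)"
        unfolding diag_op_def
        by (simp add: blinfun.sum_left blinfun.scaleR_left scaleR_sum_right sum_subtractf
            scaleR_diff_left)
      also have "\<dots> = 0"
      proof (rule sum.neutral, rule ballI)
        fix i assume "i \<in> {..<n}"
        with * have "l i - s \<noteq> 0" "s \<noteq> 0" by auto
        then have "l i * m i - l i / s - s * m i = 0"
          by (simp add: m_def divide_simps) (simp add: algebra_simps)
        then show "(l i * m i - l i / s - s * m i) *\<^sub>R line_proj (e i) x = 0" by simp
      qed
      finally show ?thesis .
    qed
    have s0: "s \<noteq> 0" using * by auto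
    have "(diag_op n e l - s *\<^sub>R id_blinfun) o\<^sub>L R = id_blinfun"
      "R o\<^sub>L (diag_op n e l - s *\<^sub>R id_blinfun) = id_blinfun"
      using 0 s0
      by (auto intro!: blinfun_eqI simp: R_def blinfun.diff_left blinfun.scaleR_left
          blinfun.diff_right blinfun.scaleR_right diag_op_diag_op[OF e] algebra_simps)
    with s show False unfolding spectrum_def by blast
  qed
qed

text \<open>
  Equal ranges give \<open>P Q = Q\<close> and \<open>Q P = P\<close>; taking adjoints in the second identity gives
  \<open>P Q = P\<close>. This makes the definite description in \<open>spectral_proj\<close> well defined.
\<close>

lemma selfadjoint_proj_unique:
  assumes "P o\<^sub>L P = P" "selfadjoint P" "Q o\<^sub>L Q = Q" "selfadjoint Q" "range P = range Q"
  shows "P = Q"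
proof (rule blinfun_eqI)
  fix x
  have fix1: "P (Q y) = Q y" for y
    using assms(1,5) by (metis blinfun_apply_blinfun_compose rangeE rangeI)
  have fix2: "Q (P y) = P y" for y
    using assms(3,5) by (metis blinfun_apply_blinfun_compose rangeE rangeI)
  have "cinner (P x) y = cinner (Q x) y" for y
  proof -
    have "cinner (P x) y = cinner x (Q (P y))"
      using assms(2) by (simp add: selfadjoint_def fix2)
    also have "\<dots> = cinner (P (Q x)) y"
      using assms(2,4) by (simp add: selfadjoint_def)
    finally show ?thesis by (simp add: fix1)
  qed
  then have "cinner (P x - Q x) (P x - Q x) = 0"
    by (simp add: cinner_diff_left)
  then show "P x = Q x" by simp
qed

lemma spectral_proj_diag_op:
  assumes e: "orthonormal n e" and l: "inj_on l {..<n}" and j: "j < n" and l0: "l j \<noteq> 0"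
  shows "spectral_proj (diag_op n e l) (l j) = line_proj (e j)"
proof -
  have 1: "line_proj (e j) o\<^sub>L line_proj (e j) = line_proj (e j)"
    using orthonormalD[OF e j j]
    by (intro blinfun_eqI) (simp add: line_proj.rep_eq cinner_scaleC_left)
  have 2: "selfadjoint (line_proj (e j))"
    by (simp add: selfadjoint_def line_proj.rep_eq cinner_scaleC_left cinner_scaleC_right
        cinner_commute[of "e j"])
  have 3: "range (line_proj (e j)) = {x. diag_op n e l x = l j *\<^sub>R x}"
  proof (intro equalityI subsetI CollectI)
    fix y assume "y \<in> range (line_proj (e j))"
    then obtain c where y: "y = c *\<^sub>C e j" by (auto simp: line_proj.rep_eq)
    have "diag_op n e l y = c *\<^sub>C diag_op n e l (e j)"
      unfolding y diag_op_apply
      by (simp add: cinner_scaleC_left complex_vector.scale_sum_right scaleC_scaleC ac_simps)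
    also have "\<dots> = l j *\<^sub>R y"
      by (simp add: y diag_op_basis[OF e j] scaleC_scaleC mult.commute flip: scaleC_of_real)
    finally show "diag_op n e l y = l j *\<^sub>R y" .
  next
    fix x assume "x \<in> {x. diag_op n e l x = l j *\<^sub>R x}"
    then have x: "diag_op n e l x = complex_of_real (l j) *\<^sub>C x"
      by (simp add: scaleC_of_real)
    have other: "cinner x (e i) = 0" if "i < n" "i \<noteq> j" for i
    proof -
      have "complex_of_real (l i) * cinner x (e i) = complex_of_real (l j) * cinner x (e i)"
        using cinner_diag_op[OF e \<open>i < n\<close>, of l x] unfolding x cinner_scaleC_left by (rule sym)
      moreover have "l i \<noteq> l j"
        using l that j by (auto dest: inj_onD)
      ultimately show ?thesis by (metis mult_right_cancel of_real_eq_iff)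
    qed
    have "complex_of_real (l j) *\<^sub>C x
        = (\<Sum>i<n. if i = j then (complex_of_real (l j) * cinner x (e j)) *\<^sub>C e j else 0)"
      unfolding x[symmetric] diag_op_apply by (intro sum.cong) (auto simp: other)
    also have "\<dots> = complex_of_real (l j) *\<^sub>C line_proj (e j) x"
      using j by (simp add: sum.delta' line_proj.rep_eq scaleC_scaleC)
    finally have "x = line_proj (e j) x"
      using l0 by (simp add: complex_vector.scale_left_imp_eq)
    then show "x \<in> range (line_proj (e j))" by (metis rangeI)
  qed
  show ?thesis
    unfolding spectral_proj_def
  proof (rule the_equality)
    fix P assume P: "P o\<^sub>L P = P \<and> selfadjoint P \<and> range P = {x. diag_op n e l x = l j *\<^sub>R x}"
    show "P = line_proj (e j)"
    proof (rule selfadjoint_proj_unique[OF _ _ 1 2])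
      show "P o\<^sub>L P = P" "selfadjoint P"
        using P by blast+
      show "range P = range (line_proj (e j))"
        unfolding 3 using P by blast
    qed
  qed (intro conjI 1 2 3)
qed

section \<open>Functions of two diagonal operators\<close>

lemma scaleC_op_zero [simp]: "scaleC_op 0 T = 0"
  by (intro blinfun_eqI) (simp add: scaleC_op.rep_eq)

lemma sum_spectrum_diag_op:
  fixes F :: "real \<Rightarrow> 'b::comm_monoid_add"
  assumes e: "orthonormal n e" and l: "inj_on l {..<n}" and F: "F 0 = 0"
  shows "(\<Sum>s\<in>spectrum (diag_op n e l). F s) = (\<Sum>i<n. F (l i))"
proof -
  have "e i \<noteq> 0" if "i < n" for i
    using orthonormalD[OF e that that] by auto
  then have sup: "l ` {..<n} \<subseteq> spectrum (diag_op n e l)"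
    by (auto intro!: eigenvalue_in_spectrum diag_op_basis[OF e])
  note sub = spectrum_diag_op_subset[OF e, of l]
  have "(\<Sum>s\<in>spectrum (diag_op n e l). F s) = (\<Sum>s\<in>l ` {..<n}. F s)"
    by (rule sum.mono_neutral_right) (use sub sup F in \<open>auto intro: finite_subset\<close>)
  then show ?thesis
    by (simp add: sum.reindex[OF l])
qed

text \<open>
  The spectrum may contain \<open>0\<close> in addition to the prescribed eigenvalues. Functions vanishing on
  both coordinate axes do not see it, which turns \<open>op_fun\<close> into the finite sum over eigenvectors.
\<close>

lemma op_fun_diag_op:
  assumes e: "orthonormal n e" and l: "inj_on l {..<n}" and l0: "\<And>i. i < n \<Longrightarrow> l i \<noteq> 0"
    and h: "orthonormal m h" and k: "inj_on k {..<m}" and k0: "\<And>i. i < m \<Longrightarrow> k i \<noteq> 0"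
    and f: "\<And>t. f (0, t) = 0" "\<And>s. f (s, 0) = 0"
  shows "op_fun f (diag_op n e l) (diag_op m h k)
    = (\<Sum>i<n. \<Sum>j<m. scaleC_op (f (l i, k j)) (line_proj (e i) o\<^sub>L line_proj (h j)))"
proof -
  have "op_fun f (diag_op n e l) (diag_op m h k)
    = (\<Sum>i<n. \<Sum>j<m. scaleC_op (f (l i, k j))
        (spectral_proj (diag_op n e l) (l i) o\<^sub>L spectral_proj (diag_op m h k) (k j)))"
    unfolding op_fun_def by (simp add: sum_spectrum_diag_op[OF e l] sum_spectrum_diag_op[OF h k] f)
  then show ?thesis
    by (simp add: spectral_proj_diag_op[OF e l _ l0] spectral_proj_diag_op[OF h k _ k0] cong: sum.cong_simp)
qed

section \<open>The discrete Fourier basis and a large Schur product\<close>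

definition dft :: "nat \<Rightarrow> nat \<Rightarrow> nat \<Rightarrow> complex" where
  "dft n j k = cis (2 * pi * real j * real k / real n)"

lemma cmod_dft [simp]: "cmod (dft n j k) = 1"
  by (simp add: dft_def)

lemma dft_mult_cnj [simp]: "dft n j k * cnj (dft n j k) = 1"
  unfolding complex_norm_square[symmetric] by simp

text \<open>
  The terms are the powers of \<open>z = exp (2 \<pi> \<i> (k - l) / n)\<close>, an \<open>n\<close>-th root of unity which is
  \<open>1\<close> only for \<open>k = l\<close>; otherwise the geometric sum vanishes.
\<close>

lemma dft_orthogonal:
  assumes "k < n" "l < n"
  shows "(\<Sum>j<n. dft n j k * cnj (dft n j l)) = (if k = l then of_nat n else 0)"
proof (cases "k = l")
  case False
  define z where "z = cis (2 * pi * (real k - real l) / real n)"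
  have n: "n > 0" using assms by simp
  have z: "dft n j k * cnj (dft n j l) = z ^ j" for j
  proof -
    have "dft n j k * cnj (dft n j l)
        = cis (2 * pi * real j * real k / real n - 2 * pi * real j * real l / real n)"
      by (simp add: dft_def cis_cnj cis_mult)
    also have "\<dots> = cis (real j * (2 * pi * (real k - real l) / real n))"
      by (rule arg_cong[where f = cis]) (simp add: algebra_simps diff_divide_distrib)
    finally show ?thesis by (simp only: z_def Complex.DeMoivre)
  qed
  have zn: "z ^ n = 1"
  proof -
    have "z ^ n = cis (2 * pi * real_of_int (int k - int l))"
      using n by (simp add: z_def Complex.DeMoivre)
    then show ?thesis by (simp add: cis_multiple_2pi)
  qed
  have "z \<noteq> 1"
  proof
    assume "z = 1"
    have "cis (2 * pi * real k / real n) = z * cis (2 * pi * real l / real n)"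
      by (simp add: z_def cis_mult algebra_simps diff_divide_distrib)
    then have "exp (2 * of_real pi * \<i> * of_nat k / of_nat n) = exp (2 * of_real pi * \<i> * of_nat l / of_nat n)"
      unfolding \<open>z = 1\<close> by (simp add: cis_conv_exp mult_ac)
    then have "k mod n = l mod n"
      using n by (subst (asm) complex_root_unity_eq) auto
    with assms False show False by simp
  qed
  then have "(\<Sum>j<n. z ^ j) = 0"
    by (simp add: geometric_sum zn)
  with False show ?thesis by (simp add: z)
qed simp

definition fourier_basis :: "nat \<Rightarrow> (nat \<Rightarrow> 'a::complex_hilbert_space) \<Rightarrow> nat \<Rightarrow> 'a" where
  "fourier_basis n e k = (\<Sum>j<n. (dft n j k / complex_of_real (sqrt n)) *\<^sub>C e j)"

lemma cinner_fourier_basis: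
  assumes "orthonormal n e" "j < n"
  shows "cinner (fourier_basis n e k) (e j) = dft n j k / complex_of_real (sqrt n)"
  unfolding fourier_basis_def by (rule cinner_orthonormal_sum[OF assms])

lemma orthonormal_fourier_basis:
  assumes e: "orthonormal n e"
  shows "orthonormal n (fourier_basis n e)"
  unfolding orthonormal_def
proof (intro allI impI)
  fix k l assume kl: "k < n" "l < n"
  have sq: "complex_of_real (sqrt n) * complex_of_real (sqrt n) = of_nat n"
    by (simp flip: of_real_mult)
  have "cinner (fourier_basis n e k) (fourier_basis n e l)
      = (\<Sum>j<n. cnj (dft n j l / complex_of_real (sqrt n)) * (dft n j k / complex_of_real (sqrt n)))"
    by (subst (2) fourier_basis_def)
      (simp add: cinner_sum_right cinner_scaleC_right cinner_fourier_basis[OF e])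
  also have "\<dots> = (\<Sum>j<n. dft n j k * cnj (dft n j l)) / of_nat n"
    by (simp add: sum_divide_distrib mult.commute sq)
  also have "\<dots> = (if k = l then 1 else 0)"
    using kl by (simp add: dft_orthogonal)
  finally show "cinner (fourier_basis n e k) (fourier_basis n e l) = (if k = l then 1 else 0)" .
qed

text \<open>
  In the two bases, \<open>T\<close> is the Schur product of the unitary matrix \<open>dft n i k / sqrt n\<close> with the
  conjugate phases of its entries, that is, the matrix all of whose entries are \<open>1 / sqrt n\<close>. It
  maps the vector with all coordinates \<open>1\<close>, of norm \<open>sqrt n\<close>, to the vector with all coordinates
  \<open>sqrt n\<close>, of norm \<open>n\<close>.
\<close>

lemma schur_multiplier_lower_bound:
  fixes e :: "nat \<Rightarrow> 'a::complex_hilbert_space"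
  assumes e: "orthonormal n e" and n: "n > 0"
  defines "T \<equiv> (\<Sum>i<n. \<Sum>k<n. scaleC_op (cnj (dft n i k))
      (line_proj (e i) o\<^sub>L line_proj (fourier_basis n e k)))"
  shows "sqrt n \<le> norm T"
proof -
  let ?h = "fourier_basis n e"
  define v where "v = (\<Sum>k<n. 1 *\<^sub>C ?h k)"
  note h = orthonormal_fourier_basis[OF e]
  have v: "norm v = sqrt n"
    unfolding v_def norm_orthonormal_sum[OF h] by simp
  have vh: "cinner v (?h k) = 1" if "k < n" for k
    unfolding v_def by (rule cinner_orthonormal_sum[OF h that])
  have "T v = (\<Sum>i<n. \<Sum>k<n. (1 / complex_of_real (sqrt n)) *\<^sub>C e i)"
    unfolding T_def blinfun.sum_left
  proof (intro sum.cong refl)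
    fix i k assume ik: "i \<in> {..<n}" "k \<in> {..<n}"
    have "cnj (dft n i k) * (dft n i k / complex_of_real (sqrt n)) = 1 / complex_of_real (sqrt n)"
      by (simp add: mult.commute)
    then show "scaleC_op (cnj (dft n i k)) (line_proj (e i) o\<^sub>L line_proj (?h k)) v
        = (1 / complex_of_real (sqrt n)) *\<^sub>C e i"
      using ik by (simp add: scaleC_op.rep_eq line_proj.rep_eq vh cinner_fourier_basis[OF e]
          scaleC_scaleC)
  qed
  also have "\<dots> = (\<Sum>i<n. (of_nat n / complex_of_real (sqrt n)) *\<^sub>C e i)"
    by (simp add: complex_vector.sum_constant_scale scaleC_scaleC)
  also have "norm \<dots> = n"
    using n unfolding norm_orthonormal_sum[OF e]
    by (simp add: norm_divide power_divide real_sqrt_mult)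
  finally have "real n \<le> norm T * sqrt n"
    using norm_blinfun[of T v] v by simp
  then have "sqrt n * sqrt n \<le> norm T * sqrt n"
    by (simp only: real_sqrt_mult_self abs_of_nat)
  then show ?thesis
    by (rule mult_right_le_imp_le) (use n in simp)
qed

section \<open>The Fejer kernel as an entire function\<close>

definition csinc :: "complex \<Rightarrow> complex" where
  "csinc z = (if z = 0 then 1 else sin z / z)"

lemma holomorphic_csinc: "csinc holomorphic_on UNIV"
proof -
  have "deriv sin (0::complex) = 1"
    using DERIV_imp_deriv[OF DERIV_sin[of "0::complex"]] by simp
  then have eq: "csinc = (\<lambda>z. if z = 0 then deriv sin 0 else (sin z - sin 0) / (z - 0))"
    by (auto simp: fun_eq_iff csinc_def)
  show ?thesis
    unfolding eq by (intro pole_lemma_open holomorphic_intros) auto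
qed

text \<open>
  On the real line this is \<open>(sin (x / 2) / (x / 2))\<^sup>2\<close>, the Fourier transform of a triangle
  function supported in \<open>[-1, 1]\<close>. Its zeros are the nonzero multiples of \<open>2 \<pi>\<close>.
\<close>

definition fejer :: "complex \<Rightarrow> complex" where
  "fejer z = (csinc (z / 2))\<^sup>2"

lemma holomorphic_fejer: "fejer holomorphic_on UNIV"
proof -
  have "(csinc \<circ> (\<lambda>z. z / 2)) holomorphic_on UNIV"
    by (intro holomorphic_on_compose_gen[OF _ holomorphic_csinc] holomorphic_intros) auto
  then show ?thesis
    unfolding fejer_def[abs_def] o_def by (rule holomorphic_on_power)
qed

lemma fejer_minus: "fejer (- z) = fejer z"
  by (simp add: fejer_def csinc_def)

lemma fejer_0 [simp]: "fejer 0 = 1"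
  by (simp add: fejer_def csinc_def)

lemma fejer_zeros:
  assumes "k \<noteq> 0"
  shows "fejer (complex_of_real (2 * pi * of_int k)) = 0"
proof -
  have "sin (complex_of_real (pi * of_int k)) = 0"
    unfolding sin_of_real by (simp add: mult.commute)
  with assms show ?thesis
    by (simp add: fejer_def csinc_def)
qed

lemma cmod_fejer_le:
  assumes "z \<noteq> 0"
  shows "cmod (fejer z) \<le> 4 * exp \<bar>Im z\<bar> / (cmod z)\<^sup>2"
proof -
  have "(cmod (sin (z / 2)))\<^sup>2 \<le> (exp \<bar>Im (z / 2)\<bar>)\<^sup>2"
    using cmod_sin_le_exp[of 1 "z / 2"] by (intro power_mono) auto
  also have "\<dots> = exp \<bar>Im z\<bar>"
    by (simp flip: exp_double)
  finally show ?thesis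
    using assms by (simp add: fejer_def csinc_def norm_divide norm_power power_divide divide_simps)
qed

lemma cmod_fejer_real_le: "cmod (fejer (complex_of_real x)) \<le> 5 / (1 + x\<^sup>2)"
proof (cases "x = 0")
  case False
  have s: "sin (complex_of_real x / 2) = complex_of_real (sin (x / 2))"
    using sin_of_real[of "x / 2", where 'a = complex] by simp
  have "cmod (csinc (complex_of_real x / 2)) = \<bar>sin (x / 2)\<bar> / \<bar>x / 2\<bar>"
    using False by (simp add: csinc_def norm_divide s)
  also have "\<dots> \<le> 1"
    using False abs_sin_x_le_abs_x[of "x / 2"] by (simp add: divide_simps)
  finally have "cmod (fejer (complex_of_real x)) \<le> 1"
    by (simp add: fejer_def norm_power power_le_one)
  moreover have "cmod (fejer (complex_of_real x)) * x\<^sup>2 \<le> 4"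
    using cmod_fejer_le[of "complex_of_real x"] False by (simp add: divide_simps split: if_splits)
  ultimately have "cmod (fejer (complex_of_real x)) * (1 + x\<^sup>2) \<le> 5"
    by (simp add: algebra_simps)
  then show ?thesis
    by (simp add: pos_le_divide_eq add_pos_nonneg)
qed simp

lemma borel_measurable_entire_on_reals:
  assumes "g holomorphic_on UNIV"
  shows "(\<lambda>x. g (complex_of_real x)) \<in> borel_measurable borel"
proof -
  have "continuous_on UNIV g"
    using assms by (rule holomorphic_on_imp_continuous_on)
  then have "continuous_on UNIV (\<lambda>x. g (complex_of_real x))"
    by (rule continuous_on_compose2) (auto intro!: continuous_intros)
  then show ?thesis by (rule borel_measurable_continuous_onI)
qed

lemma integrable_fejer: "integrable lborel (\<lambda>x. fejer (complex_of_real x))"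
proof (rule Bochner_Integration.integrable_bound)
  show "integrable lborel (\<lambda>x::real. 5 * inverse (1 + x\<^sup>2))"
    using integrable_inverse_1_plus_square by (simp add: set_integrable_def)
  show "(\<lambda>x. fejer (complex_of_real x)) \<in> borel_measurable lborel"
    using borel_measurable_entire_on_reals[OF holomorphic_fejer] by simp
  show "AE x in lborel. norm (fejer (complex_of_real x)) \<le> norm (5 * inverse (1 + x\<^sup>2))"
    using cmod_fejer_real_le by (simp add: divide_inverse)
qed

section \<open>Fourier transforms of integrable functions\<close>

text \<open>
  By Cauchy's theorem the integral over \<open>[-R, R]\<close> is minus the integral over the upper half-circle
  of radius \<open>R\<close>, which is at most \<open>C / R\<^sup>2 * R * pi\<close> and so tends to \<open>0\<close>.
\<close>

lemma entire_integral_eq_0: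
  assumes hol: "G holomorphic_on UNIV"
    and int: "integrable lborel (\<lambda>x. G (complex_of_real x))"
    and bound: "\<And>z. Im z \<ge> 0 \<Longrightarrow> z \<noteq> 0 \<Longrightarrow> cmod (G z) \<le> C / (cmod z)\<^sup>2"
  shows "(LINT x|lborel. G (complex_of_real x)) = 0"
proof -
  let ?I = "\<lambda>R. integral {-R..R} (\<lambda>x. G (complex_of_real x))"
  have C: "C \<ge> 0"
    using order_trans[OF norm_ge_zero bound[of 1]] by simp
  have bnd: "cmod (?I R) \<le> C * pi / R" if R: "R > 0" for R
  proof -
    let ?l = "linepath (complex_of_real (- R)) (complex_of_real R)"
    let ?c = "part_circlepath 0 R 0 pi"
    have cont: "continuous_on S G" for S
      using holomorphic_on_imp_continuous_on[OF hol] continuous_on_subset by blast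
    have l: "G contour_integrable_on ?l"
      by (intro contour_integrable_continuous_linepath cont)
    have c: "G contour_integrable_on ?c"
      by (intro contour_integrable_continuous_part_circlepath cont)
    have "(G has_contour_integral 0) (?l +++ ?c)"
      by (rule Cauchy_theorem_convex_simple[OF hol convex_UNIV]) (auto intro!: valid_path_join)
    then have "contour_integral ?l G + contour_integral ?c G = 0"
      using l c by (metis contour_integral_join contour_integral_unique valid_path_linepath
          valid_path_part_circlepath)
    then have "cmod (contour_integral ?l G) = cmod (contour_integral ?c G)"
      by (metis add.inverse_unique norm_minus_cancel)
    also have "\<dots> \<le> C / R\<^sup>2 * R * \<bar>pi - 0\<bar>"
    proof (rule contour_integral_bound_part_circlepath[OF c])
      fix z assume "z \<in> path_image ?c"
      then have "z \<in> (\<lambda>t. complex_of_real R * cis t) ` {0..pi}"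
        by (simp add: path_image_part_circlepath' closed_segment_eq_real_ivl)
      then obtain t where t: "z = complex_of_real R * cis t" "t \<in> {0..pi}"
        by blast
      with R show "norm (G z) \<le> C / R\<^sup>2"
        using bound[of z] by (auto simp: norm_mult sin_ge_zero)
    qed (use C R in auto)
    also have "contour_integral ?l G = ?I R"
      using R by (subst contour_integral_linepath_Reals_eq) auto
    finally show ?thesis
      using R by (simp add: power2_eq_square)
  qed
  have "(\<lambda>n. ?I (real n)) \<longlonglongrightarrow> 0"
  proof (rule Lim_null_comparison)
    show "\<forall>\<^sub>F n in sequentially. cmod (?I (real n)) \<le> C * pi / real n"
      using eventually_gt_at_top[of 0] by eventually_elim (rule bnd, simp)
    show "(\<lambda>n. C * pi / real n) \<longlonglongrightarrow> 0"
      by (intro tendsto_divide_0[OF tendsto_const] filterlim_real_sequentially[THEN filterlim_at_top_imp_at_infinity])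
  qed
  moreover have "(\<lambda>n. ?I (real n)) \<longlonglongrightarrow> (LINT x|lborel. G (complex_of_real x))"
  proof -
    have "?I (real n) = (LINT x|lborel. indicator {-real n..real n} x *\<^sub>R G (complex_of_real x))" for n
      using set_borel_integral_eq_integral(2)[of "{-real n..real n}" "\<lambda>x. G (complex_of_real x)"]
        integrable_mult_indicator[OF _ int, of "{-real n..real n}"]
      by (simp add: set_integrable_def set_lebesgue_integral_def)
    moreover have "(\<lambda>n. LINT x|lborel. indicator {-real n..real n} x *\<^sub>R G (complex_of_real x))
      \<longlonglongrightarrow> (LINT x|lborel. G (complex_of_real x))"
    proof (rule integral_dominated_convergence)
      show "integrable lborel (\<lambda>x. norm (G (complex_of_real x)))"
        using int by (rule integrable_norm)
      show "AE x in lborel. (\<lambda>n. indicator {-real n..real n} x *\<^sub>R G (complex_of_real x)) \<longlonglongrightarrow> G (complex_of_real x)"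
      proof (rule AE_I2)
        fix x :: real
        obtain N where N: "\<bar>x\<bar> \<le> real N"
          using real_arch_simple by blast
        have "\<forall>\<^sub>F n in sequentially. indicator {-real n..real n} x *\<^sub>R G (complex_of_real x) = G (complex_of_real x)"
          using eventually_ge_at_top[of N] by eventually_elim (use N in \<open>auto simp: indicator_def\<close>)
        then show "(\<lambda>n. indicator {-real n..real n} x *\<^sub>R G (complex_of_real x)) \<longlonglongrightarrow> G (complex_of_real x)"
          by (rule tendsto_eventually)
      qed
    qed (use int in \<open>auto simp: indicator_def\<close>)
    ultimately show ?thesis by simp
  qed
  ultimately show ?thesis using LIMSEQ_unique by blast
qed

lemma integrable_mult_exp_inner:
  fixes f :: "'a::euclidean_space \<Rightarrow> complex"
  assumes "integrable lborel f"
  shows "integrable lborel (\<lambda>x. f x * exp (- \<i> * complex_of_real (x \<bullet> \<xi>)))"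
proof (rule Bochner_Integration.integrable_bound[OF assms])
  show "(\<lambda>x. f x * exp (- \<i> * complex_of_real (x \<bullet> \<xi>))) \<in> borel_measurable lborel"
    using borel_measurable_integrable[OF assms] by measurable
qed (simp add: norm_mult)

lemma fourier_reflect:
  fixes f :: "real \<Rightarrow> complex"
  shows "fourier (\<lambda>x. f (- x)) \<xi> = fourier f (- \<xi>)"
  unfolding fourier_def by (subst lborel_integral_real_affine[where c = "-1" and t = 0]) auto

lemma fourier_translate:
  fixes f :: "real \<Rightarrow> complex"
  shows "fourier (\<lambda>x. f (x - a)) \<xi> = exp (- \<i> * complex_of_real (a * \<xi>)) * fourier f \<xi>"
proof -
  have e: "exp (- \<i> * complex_of_real ((a + x) * \<xi>))
      = exp (- \<i> * complex_of_real (a * \<xi>)) * exp (- \<i> * complex_of_real (x * \<xi>))" for x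
    by (simp add: algebra_simps flip: exp_add)
  have "fourier (\<lambda>x. f (x - a)) \<xi> = (LINT x|lborel. f x * exp (- \<i> * complex_of_real ((a + x) * \<xi>)))"
    unfolding fourier_def by (subst lborel_integral_real_affine[where c = 1 and t = a]) simp_all
  also have "\<dots> = (LINT x|lborel. exp (- \<i> * complex_of_real (a * \<xi>))
      * (f x * exp (- \<i> * complex_of_real (x * \<xi>))))"
    unfolding e by (simp only: mult.left_commute)
  finally show ?thesis
    unfolding fourier_def by simp
qed

lemma fourier_cmult: "fourier (\<lambda>x. c * f x) \<xi> = c * fourier f \<xi>"
  by (simp add: fourier_def mult.assoc)

text \<open>
  A Paley--Wiener argument. For \<open>\<xi> \<le> -1\<close> the growth \<open>exp (Im z)\<close> of the kernel in the upper
  half-plane is compensated by \<open>\<bar>exp (- \<i> z \<xi>)\<bar> = exp (\<xi> Im z)\<close>, and the contour can be pushed to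
  infinity. The case \<open>\<xi> \<ge> 1\<close> follows because the kernel is even.
\<close>

lemma fourier_fejer:
  assumes "\<bar>\<xi>\<bar> \<ge> 1"
  shows "fourier (\<lambda>x::real. fejer (complex_of_real x)) \<xi> = 0"
proof -
  have neg: "fourier (\<lambda>x::real. fejer (complex_of_real x)) \<xi> = 0" if "\<xi> \<le> -1" for \<xi>
  proof -
    define G where "G = (\<lambda>z. fejer z * exp (- \<i> * z * complex_of_real \<xi>))"
    have "(LINT x|lborel. G (complex_of_real x)) = 0"
    proof (rule entire_integral_eq_0[where C = 4])
      show "G holomorphic_on UNIV"
        unfolding G_def by (intro holomorphic_intros holomorphic_fejer)
      show "integrable lborel (\<lambda>x. G (complex_of_real x))"
        using integrable_mult_exp_inner[OF integrable_fejer, of \<xi>] by (simp add: G_def mult.assoc)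
      fix z :: complex assume z: "Im z \<ge> 0" "z \<noteq> 0"
      have "cmod (G z) = cmod (fejer z) * exp (Im z * \<xi>)"
        by (simp add: G_def norm_mult)
      also have "\<dots> \<le> 4 * exp \<bar>Im z\<bar> / (cmod z)\<^sup>2 * exp (- Im z)"
        using z that mult_left_mono[of \<xi> "-1" "Im z"] by (intro mult_mono cmod_fejer_le) auto
      also have "\<dots> = 4 / (cmod z)\<^sup>2"
        using z by (simp add: exp_minus)
      finally show "cmod (G z) \<le> 4 / (cmod z)\<^sup>2" .
    qed
    then show ?thesis by (simp add: fourier_def G_def mult.assoc)
  qed
  show ?thesis
  proof (cases "\<xi> \<le> -1")
    case False
    with assms have "- \<xi> \<le> -1" by simp
    from neg[OF this] show ?thesis
      using fourier_reflect[of "\<lambda>x. fejer (complex_of_real x)" \<xi>] by (simp add: fejer_minus)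
  qed (rule neg)
qed

lemma (in pair_sigma_finite) integrable_tensor:
  fixes f :: "'a \<Rightarrow> complex" and g :: "'b \<Rightarrow> complex"
  assumes f: "integrable M1 f" and g: "integrable M2 g"
  shows "integrable (M1 \<Otimes>\<^sub>M M2) (\<lambda>p. f (fst p) * g (snd p))"
proof (rule Fubini_integrable)
  have [measurable]: "f \<in> borel_measurable M1" "g \<in> borel_measurable M2"
    using f g by auto
  show "(\<lambda>p. f (fst p) * g (snd p)) \<in> borel_measurable (M1 \<Otimes>\<^sub>M M2)"
    by measurable
  show "integrable M1 (\<lambda>x. LINT y|M2. norm (f (fst (x, y)) * g (snd (x, y))))"
    using f by (simp add: norm_mult)
  show "AE x in M1. integrable M2 (\<lambda>y. f (fst (x, y)) * g (snd (x, y)))"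
    using g by simp
qed

lemma integrable_lborel_tensor:
  fixes f :: "'a::euclidean_space \<Rightarrow> complex" and g :: "'b::euclidean_space \<Rightarrow> complex"
  assumes "integrable lborel f" "integrable lborel g"
  shows "integrable lborel (\<lambda>p. f (fst p) * g (snd p))"
  using lborel_pair.integrable_tensor[OF assms] by (simp add: lborel_prod)

lemma fourier_tensor:
  fixes f :: "'a::euclidean_space \<Rightarrow> complex" and g :: "'b::euclidean_space \<Rightarrow> complex"
  assumes f: "integrable lborel f" and g: "integrable lborel g"
  shows "fourier (\<lambda>p. f (fst p) * g (snd p)) (s, t) = fourier f s * fourier g t"
proof -
  let ?f = "\<lambda>x. f x * exp (- \<i> * complex_of_real (x \<bullet> s))"
  let ?g = "\<lambda>y. g y * exp (- \<i> * complex_of_real (y \<bullet> t))"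
  have "fourier (\<lambda>p. f (fst p) * g (snd p)) (s, t)
      = (LINT p|(lborel \<Otimes>\<^sub>M lborel). ?f (fst p) * ?g (snd p))"
    unfolding fourier_def lborel_prod
    by (intro Bochner_Integration.integral_cong)
      (auto simp: inner_prod_def algebra_simps simp flip: exp_add)
  also have "\<dots> = (LINT x|lborel. LINT y|lborel. ?f x * ?g y)"
    using lborel_pair.integral_fst'[OF lborel_pair.integrable_tensor[OF
        integrable_mult_exp_inner[OF f, of s] integrable_mult_exp_inner[OF g, of t]]] by simp
  also have "\<dots> = fourier f s * fourier g t"
    by (simp add: fourier_def)
  finally show ?thesis .
qed

text \<open>
  The multiplication formula, by Fubini: on integrable functions the distributional Fourier
  transform is given by the Fourier integral.
\<close>

lemma fourier_distr_integrable:
  fixes f \<psi> :: "'a::euclidean_space \<Rightarrow> complex"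
  assumes f: "integrable lborel f" and \<psi>: "integrable lborel \<psi>"
  shows "fourier_distr f \<psi> = (LINT x|lborel. \<psi> x * fourier f x)"
proof -
  let ?K = "\<lambda>\<xi> x. f \<xi> * \<psi> x * exp (- \<i> * complex_of_real (x \<bullet> \<xi>))"
  have [measurable]: "f \<in> borel_measurable borel" "\<psi> \<in> borel_measurable borel"
    using f \<psi> by auto
  have "integrable (lborel \<Otimes>\<^sub>M lborel) (case_prod ?K)"
  proof (rule Bochner_Integration.integrable_bound[OF lborel_pair.integrable_tensor[OF f \<psi>]])
    show "case_prod ?K \<in> borel_measurable (lborel \<Otimes>\<^sub>M lborel)"
      by measurable
  qed (auto simp: norm_mult)
  then have "(LINT x|lborel. LINT \<xi>|lborel. ?K \<xi> x) = (LINT \<xi>|lborel. LINT x|lborel. ?K \<xi> x)"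
    by (rule lborel_pair.Fubini_integral)
  moreover have "(LINT x|lborel. ?K \<xi> x) = f \<xi> * fourier \<psi> \<xi>" for \<xi>
    by (simp add: fourier_def mult.assoc)
  moreover have "(LINT \<xi>|lborel. ?K \<xi> x) = \<psi> x * fourier f x" for x
    by (simp add: fourier_def inner_commute ac_simps flip: integral_mult_right_zero)
  ultimately show ?thesis
    by (simp add: fourier_distr_def)
qed

lemma integrable_test_function:
  fixes \<psi> :: "'a::euclidean_space \<Rightarrow> complex"
  assumes "schwartz \<psi>" "compact (fun_support \<psi>)"
  shows "integrable lborel \<psi>"
proof -
  have "iter_deriv [] \<psi> differentiable (at x)" for x
    using assms(1) unfolding schwartz_def smooth_def by blast
  then have "continuous_on (fun_support \<psi>) \<psi>"
    by (auto intro!: continuous_at_imp_continuous_on differentiable_imp_continuous_within)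
  then have "integrable lborel (\<lambda>x. indicator (fun_support \<psi>) x *\<^sub>R \<psi> x)"
    by (rule borel_integrable_compact[OF assms(2)])
  also have "(\<lambda>x. indicator (fun_support \<psi>) x *\<^sub>R \<psi> x) = \<psi>"
  proof (rule ext)
    fix x
    show "indicator (fun_support \<psi>) x *\<^sub>R \<psi> x = \<psi> x"
      using closure_subset[of "{x. \<psi> x \<noteq> 0}"]
      by (cases "\<psi> x = 0") (auto simp: fun_support_def)
  qed
  finally show ?thesis .
qed

lemma distr_support_fourier_subset:
  fixes f :: "'a::euclidean_space \<Rightarrow> complex"
  assumes f: "integrable lborel f" and K: "closed K" and 0: "\<And>x. x \<notin> K \<Longrightarrow> fourier f x = 0"
  shows "distr_support (fourier_distr f) \<subseteq> K"
proof -
  have "fourier_distr f \<psi> = 0"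
    if \<psi>: "schwartz \<psi>" "compact (fun_support \<psi>)" "fun_support \<psi> \<subseteq> - K" for \<psi>
  proof -
    have "(\<lambda>x. \<psi> x * fourier f x) = (\<lambda>x. 0)"
    proof (rule ext)
      fix x
      show "\<psi> x * fourier f x = 0"
        using 0 \<psi>(3) closure_subset[of "{x. \<psi> x \<noteq> 0}"]
        by (cases "\<psi> x = 0") (auto simp: fun_support_def)
    qed
    then show ?thesis
      unfolding fourier_distr_integrable[OF f integrable_test_function[OF \<psi>(1,2)]] by simp
  qed
  then show ?thesis
    using K unfolding distr_support_def by blast
qed

section \<open>Smoothness of sums of products of entire functions\<close>

text \<open>
  The class is closed under directional derivatives, since
  \<open>D\<^sub>v (g(x) h(y)) = (v\<^sub>1 g'(x)) h(y) + g(x) (v\<^sub>2 h'(y))\<close> with \<open>g'\<close>, \<open>h'\<close> again entire, so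
  that smoothness follows by induction on the number of derivatives.
\<close>

inductive entire_tensor :: "(real \<times> real \<Rightarrow> complex) \<Rightarrow> bool" where
  zero: "entire_tensor (\<lambda>p. 0)"
| add_term: "entire_tensor f \<Longrightarrow> g holomorphic_on UNIV \<Longrightarrow> h holomorphic_on UNIV \<Longrightarrow>
    entire_tensor (\<lambda>p. g (complex_of_real (fst p)) * h (complex_of_real (snd p)) + f p)"

lemma entire_tensor_sum:
  assumes "finite I" "\<And>i. i \<in> I \<Longrightarrow> g i holomorphic_on UNIV" "\<And>i. i \<in> I \<Longrightarrow> h i holomorphic_on UNIV"
  shows "entire_tensor (\<lambda>p. \<Sum>i\<in>I. g i (complex_of_real (fst p)) * h i (complex_of_real (snd p)))"
  using assms
proof (induction I)
  case (insert i I)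
  then have "entire_tensor (\<lambda>p. \<Sum>i\<in>I. g i (complex_of_real (fst p)) * h i (complex_of_real (snd p)))"
    by simp
  from entire_tensor.add_term[OF this, of "g i" "h i"] insert show ?case by simp
qed (simp add: entire_tensor.zero)

lemma entire_on_reals_has_derivative:
  assumes "g holomorphic_on UNIV" and \<phi>: "(\<phi> has_derivative \<phi>') (at p)"
  shows "((\<lambda>p. g (complex_of_real (\<phi> p))) has_derivative
    (\<lambda>v. complex_of_real (\<phi>' v) * deriv g (complex_of_real (\<phi> p)))) (at p)"
proof -
  have "(g has_field_derivative deriv g (complex_of_real (\<phi> p))) (at (complex_of_real (\<phi> p)))"
    using assms(1) by (simp add: holomorphic_derivI)
  then have "(g has_derivative (*) (deriv g (complex_of_real (\<phi> p)))) (at (complex_of_real (\<phi> p)))"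
    by (simp add: has_field_derivative_def)
  from has_derivative_compose[OF has_derivative_of_real[OF \<phi>] this] show ?thesis
    by (simp add: mult.commute)
qed

lemma entire_tensor_has_derivative:
  assumes "entire_tensor f"
  shows "\<exists>f'. (\<forall>p. (f has_derivative f' p) (at p)) \<and> (\<forall>v. entire_tensor (\<lambda>p. f' p v))"
  using assms
proof induction
  case zero
  show ?case
    by (intro exI[of _ "\<lambda>p v. 0"]) (auto intro: entire_tensor.zero)
next
  case (add_term f g h)
  from add_term.IH obtain f' where f': "\<And>p. (f has_derivative f' p) (at p)"
      "\<And>v. entire_tensor (\<lambda>p. f' p v)" by blast
  define D where "D = (\<lambda>p v.
      (complex_of_real (fst v) * deriv g (complex_of_real (fst p))) * h (complex_of_real (snd p))
      + (g (complex_of_real (fst p)) * (complex_of_real (snd v) * deriv h (complex_of_real (snd p)))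
      + f' p v))"
  have "((\<lambda>p. g (complex_of_real (fst p)) * h (complex_of_real (snd p)) + f p) has_derivative D p) (at p)"
    for p :: "real \<times> real"
    unfolding D_def
    by (rule has_derivative_eq_rhs, rule has_derivative_add[OF
          has_derivative_mult[OF
            entire_on_reals_has_derivative[OF add_term.hyps(2) has_derivative_fst[OF has_derivative_ident]]
            entire_on_reals_has_derivative[OF add_term.hyps(3) has_derivative_snd[OF has_derivative_ident]]] f'(1)])
      (auto simp: algebra_simps)
  moreover have "entire_tensor (\<lambda>p. D p v)" for v
    unfolding D_def
    using add_term.hyps by (intro entire_tensor.add_term
      [where g = "\<lambda>z. complex_of_real (fst v) * deriv g z"]
      entire_tensor.add_term[where h = "\<lambda>z. complex_of_real (snd v) * deriv h z"] f'
        holomorphic_intros) auto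
  ultimately show ?case by blast
qed

lemma smooth_entire_tensor:
  assumes "entire_tensor f"
  shows "smooth f"
proof -
  have "entire_tensor (iter_deriv vs f)" for vs
  proof (induction vs)
    case (Cons v vs)
    then obtain f' where f': "\<And>p. (iter_deriv vs f has_derivative f' p) (at p)"
        "\<And>v. entire_tensor (\<lambda>p. f' p v)" using entire_tensor_has_derivative by blast
    have "frechet_derivative (iter_deriv vs f) (at p) = f' p" for p
      using frechet_derivative_at[OF f'(1)] by simp
    with f'(2) show ?case by simp
  qed (simp add: assms)
  then show ?thesis
    unfolding smooth_def differentiable_def using entire_tensor_has_derivative by blast
qed

section \<open>Interpolation at the nodes\<close>

text \<open>
  Uniformity in \<open>x\<close> and \<open>n\<close> comes from splitting the integers at \<open>m = \<lfloor>x\<rfloor>\<close>: on either side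
  the distances from \<open>x\<close> to the integers dominate \<open>0, 1, 2, \<dots>\<close>.
\<close>

lemma sum_translates_le:
  "(\<Sum>i<n. 1 / (1 + (x - real i)\<^sup>2)) \<le> 2 * (\<Sum>i. 1 / (1 + (real i)\<^sup>2))"
proof -
  define u where "u = (\<lambda>i. 1 / (1 + (real i)\<^sup>2))"
  have u0: "u i \<ge> 0" for i by (simp add: u_def)
  have sm: "summable u"
  proof (rule summable_comparison_test_ev)
    show "\<forall>\<^sub>F i in sequentially. norm (u i) \<le> 1 / (real i)\<^sup>2"
      using eventually_gt_at_top[of 0] by eventually_elim (auto simp: u_def intro!: frac_le)
    show "summable (\<lambda>i. 1 / (real i)\<^sup>2)"
      using inverse_power_summable[of 2, where 'a = real] by (simp add: inverse_eq_divide)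
  qed
  define m where "m = \<lfloor>x\<rfloor>"
  have m: "real_of_int m \<le> x" "x < real_of_int m + 1"
    unfolding m_def by linarith+
  let ?a = "\<lambda>i. nat (m - int i)" and ?b = "\<lambda>i. nat (int i - m - 1)"
  let ?A = "{i. i < n \<and> int i \<le> m}" and ?B = "{i. i < n \<and> \<not> int i \<le> m}"
  \<comment> \<open>Both indexings \<open>?a\<close>, \<open>?b\<close> are injective, so each part is bounded by the full series.\<close>
  have part: "(\<Sum>i\<in>S. u (k i)) \<le> suminf u" if "inj_on k S" "finite S" for k :: "nat \<Rightarrow> nat" and S
    using sum_le_suminf[OF sm, of "k ` S"] that u0 by (simp add: sum.reindex)
  have le: "1 / (1 + (x - real i)\<^sup>2) \<le> u k" if "real k \<le> \<bar>x - real i\<bar>" for i k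
  proof -
    have "(real k)\<^sup>2 \<le> (x - real i)\<^sup>2"
      using power_mono[OF that, of 2] by simp
    then show ?thesis by (simp add: u_def frac_le add_pos_nonneg)
  qed
  have "(\<Sum>i<n. 1 / (1 + (x - real i)\<^sup>2))
      = (\<Sum>i\<in>?A. 1 / (1 + (x - real i)\<^sup>2)) + (\<Sum>i\<in>?B. 1 / (1 + (x - real i)\<^sup>2))"
    by (subst sum.union_disjoint[symmetric]) (auto intro!: sum.cong)
  also have "\<dots> \<le> (\<Sum>i\<in>?A. u (?a i)) + (\<Sum>i\<in>?B. u (?b i))"
  proof (intro add_mono sum_mono le)
    fix i assume "i \<in> ?A"
    then have "real (?a i) = real_of_int m - real i" by (simp add: of_nat_nat)
    with m show "real (?a i) \<le> \<bar>x - real i\<bar>" by linarith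
  next
    fix i assume "i \<in> ?B"
    then have "real (?b i) = real i - real_of_int m - 1" by (simp add: of_nat_nat)
    with m show "real (?b i) \<le> \<bar>x - real i\<bar>" by linarith
  qed
  also have "\<dots> \<le> suminf u + suminf u"
    by (intro add_mono part) (auto simp: inj_on_def)
  finally show ?thesis by (simp add: u_def)
qed

text \<open>
  The spacing \<open>4 \<pi>\<close> is twice that of the zeros of \<open>fejer\<close>, so that every translate of \<open>fejer\<close>
  to a node vanishes also at all the midpoints \<open>node i + 2 * pi\<close>; starting at \<open>4 \<pi>\<close> makes it
  vanish at \<open>0\<close>, which the kernels of the operators contribute to the spectra.
\<close>

definition node :: "nat \<Rightarrow> real" where
  "node i = 4 * pi * (real i + 1)"

lemma inj_node: "inj_on node A"
  by (auto simp: inj_on_def node_def)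

lemma node_pos: "node i > 0"
  by (simp add: node_def)

lemma fejer_node_node: "fejer (complex_of_real (node i - node j)) = (if i = j then 1 else 0)"
  using fejer_zeros[of "2 * (int i - int j)"] by (auto simp: node_def algebra_simps)

lemma fejer_node_zero: "fejer (complex_of_real (0 - node j)) = 0"
  using fejer_zeros[of "- 2 * (int j + 1)"] by (auto simp: node_def algebra_simps)

lemma fejer_shifted_node: "fejer (complex_of_real (node i + 2 * pi - node j)) = 0"
proof -
  have "2 * (int i - int j) + 1 \<noteq> 0" by presburger
  from fejer_zeros[OF this] show ?thesis by (simp add: node_def algebra_simps)
qed

definition fejer_bound :: real where
  "fejer_bound = 10 * (\<Sum>i. 1 / (1 + (real i)\<^sup>2))"

lemma sum_fejer_node_le:
  "(\<Sum>i<n. cmod (fejer (complex_of_real (x - node i)))) \<le> fejer_bound"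
proof -
  \<comment> \<open>In the coordinate \<open>y\<close> the nodes are the natural numbers; since \<open>4 \<pi> \<ge> 1\<close>, distances can
    only shrink in passing from \<open>x\<close> to \<open>y\<close>.\<close>
  define y where "y = x / (4 * pi) - 1"
  have "(\<Sum>i<n. cmod (fejer (complex_of_real (x - node i)))) \<le> (\<Sum>i<n. 5 * (1 / (1 + (y - real i)\<^sup>2)))"
  proof (rule sum_mono)
    fix i
    have *: "x - node i = 4 * pi * (y - real i)"
      by (simp add: y_def node_def field_simps)
    have "1 * \<bar>y - real i\<bar> \<le> 4 * pi * \<bar>y - real i\<bar>"
      using pi_ge_two by (intro mult_right_mono) auto
    then have "\<bar>y - real i\<bar> \<le> \<bar>x - node i\<bar>"
      unfolding * by (simp add: abs_mult)
    then have "(y - real i)\<^sup>2 \<le> (x - node i)\<^sup>2"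
      by (simp add: abs_le_square_iff)
    then have "5 / (1 + (x - node i)\<^sup>2) \<le> 5 / (1 + (y - real i)\<^sup>2)"
      by (intro divide_left_mono mult_pos_pos) (auto simp: add_pos_nonneg)
    then show "cmod (fejer (complex_of_real (x - node i))) \<le> 5 * (1 / (1 + (y - real i)\<^sup>2))"
      using cmod_fejer_real_le[of "x - node i"] by simp
  qed
  also have "\<dots> \<le> 5 * (2 * (\<Sum>i. 1 / (1 + (real i)\<^sup>2)))"
    unfolding sum_distrib_left[symmetric] by (intro mult_left_mono sum_translates_le) simp
  finally show ?thesis by (simp add: fejer_bound_def)
qed

lemma fejer_bound_nonneg: "fejer_bound \<ge> 0"
  using sum_fejer_node_le[of 0 0] by simp

lemma Linf_norm_le:
  fixes f :: "'a::euclidean_space \<Rightarrow> complex"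
  assumes "f \<in> borel_measurable borel" "C \<ge> 0" "\<And>x. cmod (f x) \<le> C"
  shows "Linf_norm f \<le> C"
proof -
  have "esssup lborel (\<lambda>x. ereal (cmod (f x))) \<le> ereal C"
    using assms by (intro esssup_I) auto
  with assms(2) show ?thesis
    unfolding Linf_norm_def
    by (cases "esssup lborel (\<lambda>x. ereal (cmod (f x)))") auto
qed

text \<open>
  The band-limited function with prescribed values \<open>a i j\<close> at the points \<open>(node i, node j)\<close>. Its
  supremum is controlled by that of the values, independently of \<open>n\<close>.
\<close>

definition interpolant :: "nat \<Rightarrow> (nat \<Rightarrow> nat \<Rightarrow> complex) \<Rightarrow> real \<times> real \<Rightarrow> complex" where
  "interpolant n a p = (\<Sum>(i, j)\<in>{..<n} \<times> {..<n}.
     a i j * fejer (complex_of_real (fst p - node i)) * fejer (complex_of_real (snd p - node j)))"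

lemma smooth_interpolant: "smooth (interpolant n a)"
proof (rule smooth_entire_tensor)
  have fn: "(\<lambda>z. fejer (z - complex_of_real c)) holomorphic_on UNIV" for c
  proof -
    have "(fejer \<circ> (\<lambda>z. z - complex_of_real c)) holomorphic_on UNIV"
      by (intro holomorphic_on_compose_gen[OF _ holomorphic_fejer] holomorphic_intros) auto
    then show ?thesis by (simp add: o_def)
  qed
  have "entire_tensor (\<lambda>p. \<Sum>q\<in>{..<n} \<times> {..<n}.
      (\<lambda>z. a (fst q) (snd q) * fejer (z - complex_of_real (node (fst q)))) (complex_of_real (fst p)) *
      (\<lambda>z. fejer (z - complex_of_real (node (snd q)))) (complex_of_real (snd p)))"
    by (rule entire_tensor_sum) (auto intro!: holomorphic_intros fn)
  then show "entire_tensor (interpolant n a)"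
    by (simp add: interpolant_def[abs_def] case_prod_unfold)
qed

lemma interpolant_bound:
  assumes "\<And>i j. cmod (a i j) \<le> 1"
  shows "cmod (interpolant n a p) \<le> fejer_bound\<^sup>2"
proof -
  let ?u = "\<lambda>x i. cmod (fejer (complex_of_real (x - node i)))"
  have "cmod (interpolant n a p)
      \<le> (\<Sum>(i, j)\<in>{..<n} \<times> {..<n}. ?u (fst p) i * ?u (snd p) j)"
    unfolding interpolant_def
  proof (intro order_trans[OF norm_sum] sum_mono, clarify)
    fix i j
    have "cmod (a i j) * (?u (fst p) i * ?u (snd p) j) \<le> 1 * (?u (fst p) i * ?u (snd p) j)"
      by (intro mult_right_mono assms) auto
    then show "cmod (a i j * fejer (complex_of_real (fst p - node i)) * fejer (complex_of_real (snd p - node j)))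
        \<le> ?u (fst p) i * ?u (snd p) j"
      by (simp add: norm_mult mult.assoc)
  qed
  also have "\<dots> = (\<Sum>i<n. ?u (fst p) i) * (\<Sum>j<n. ?u (snd p) j)"
    by (simp add: sum_product sum.cartesian_product)
  also have "\<dots> \<le> fejer_bound\<^sup>2"
    unfolding power2_eq_square
    by (intro mult_mono sum_fejer_node_le sum_nonneg fejer_bound_nonneg norm_ge_zero)
  finally show ?thesis .
qed

lemma distr_support_interpolant:
  "distr_support (fourier_distr (interpolant n a)) \<subseteq> {-1..1} \<times> {-1..1}"
proof (rule distr_support_fourier_subset)
  let ?g = "\<lambda>i x. fejer (complex_of_real (x - node i))"
  have g: "integrable lborel (?g i)" for i
    using lborel_integrable_real_affine[OF integrable_fejer, of 1 "- node i"] by simp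
  have t: "integrable lborel (\<lambda>p. a i j * (?g i (fst p) * ?g j (snd p)))" for i j
    by (intro integrable_mult_right integrable_lborel_tensor g)
  have eq: "interpolant n a = (\<lambda>p. \<Sum>(i, j)\<in>{..<n} \<times> {..<n}. a i j * (?g i (fst p) * ?g j (snd p)))"
    by (simp add: interpolant_def[abs_def] mult.assoc)
  show "integrable lborel (interpolant n a)"
    unfolding eq case_prod_unfold by (intro Bochner_Integration.integrable_sum t)
  show "closed ({-1..1::real} \<times> {-1..1::real})"
    by (intro closed_Times) auto
  fix q :: "real \<times> real"
  assume q: "q \<notin> {-1..1} \<times> {-1..1}"
  have 0: "fourier (?g i) \<xi> = 0" if "\<xi> \<notin> {-1..1}" for i \<xi>
    using fourier_translate[of "\<lambda>x. fejer (complex_of_real x)" "node i" \<xi>] fourier_fejer[of \<xi>] that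
    by auto
  have "fourier (interpolant n a) q
      = (\<Sum>r\<in>{..<n} \<times> {..<n}.
          fourier (\<lambda>p. a (fst r) (snd r) * (?g (fst r) (fst p) * ?g (snd r) (snd p))) q)"
    unfolding fourier_def eq case_prod_unfold sum_distrib_right
    by (rule Bochner_Integration.integral_sum) (rule integrable_mult_exp_inner[OF t])
  also have "\<dots> = 0"
    using q 0 by (cases q) (auto intro!: sum.neutral simp: fourier_cmult fourier_tensor[OF g g]
        simp del: of_real_diff)
  finally show "fourier (interpolant n a) q = 0" .
qed

lemma Linf_norm_interpolant:
  assumes "\<And>i j. cmod (a i j) \<le> 1"
  shows "Linf_norm (interpolant n a) \<le> fejer_bound\<^sup>2"
proof (rule Linf_norm_le[OF _ _ interpolant_bound[OF assms]])
  have "iter_deriv [] (interpolant n a) differentiable (at x)" for x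
    using smooth_interpolant unfolding smooth_def by blast
  then have "continuous_on UNIV (interpolant n a)"
    by (auto intro!: continuous_at_imp_continuous_on differentiable_imp_continuous_within)
  then show "interpolant n a \<in> borel_measurable borel"
    by (rule borel_measurable_continuous_onI)
qed simp

lemma interpolant_node:
  assumes "i < n" "j < n"
  shows "interpolant n a (node i, node j) = a i j"
proof -
  have "interpolant n a (node i, node j)
      = (\<Sum>q\<in>{..<n} \<times> {..<n}. if q = (i, j) then a i j else 0)"
    unfolding interpolant_def by (intro sum.cong) (auto simp: fejer_node_node simp del: of_real_diff split: if_splits)
  with assms show ?thesis by (simp add: sum.delta')
qed

lemma interpolant_eq_0:
  assumes "\<And>j. fejer (complex_of_real (s - node j)) = 0"
  shows "interpolant n a (s, t) = 0" "interpolant n a (t, s) = 0"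
  using assms by (auto simp: interpolant_def intro!: sum.neutral simp del: of_real_diff)

section \<open>Failure of the Lipschitz estimate\<close>

theorem theorem3p1:
  assumes "infinite_dimensional TYPE('a::complex_hilbert_space)"
  shows "\<not> (\<exists>M::real. M > 0 \<and>
    (\<forall>f :: real \<times> real \<Rightarrow> complex.
       smooth f \<and> bounded (range f) \<and>
       distr_support (fourier_distr f) \<subseteq> {-1..1} \<times> {-1..1} \<longrightarrow>
       (\<forall>A1 A2 B1 B2 :: 'a \<Rightarrow>\<^sub>L 'a.
          selfadjoint A1 \<and> finite_rank A1 \<and> selfadjoint A2 \<and> finite_rank A2 \<and>
          selfadjoint B1 \<and> finite_rank B1 \<and> selfadjoint B2 \<and> finite_rank B2 \<longrightarrow>
          norm (op_fun f A1 B1 - op_fun f A2 B2)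
            \<le> M * Linf_norm f * (norm (A1 - A2) + norm (B1 - B2)))))"
proof
  assume "\<exists>M::real. M > 0 \<and>
    (\<forall>f :: real \<times> real \<Rightarrow> complex.
       smooth f \<and> bounded (range f) \<and>
       distr_support (fourier_distr f) \<subseteq> {-1..1} \<times> {-1..1} \<longrightarrow>
       (\<forall>A1 A2 B1 B2 :: 'a \<Rightarrow>\<^sub>L 'a.
          selfadjoint A1 \<and> finite_rank A1 \<and> selfadjoint A2 \<and> finite_rank A2 \<and>
          selfadjoint B1 \<and> finite_rank B1 \<and> selfadjoint B2 \<and> finite_rank B2 \<longrightarrow>
          norm (op_fun f A1 B1 - op_fun f A2 B2)
            \<le> M * Linf_norm f * (norm (A1 - A2) + norm (B1 - B2))))"
  then obtain M :: real where M: "M > 0" and lipschitz: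
    "\<And>f A1 A2 (B1 :: 'a \<Rightarrow>\<^sub>L 'a) B2. smooth f \<Longrightarrow> bounded (range f) \<Longrightarrow>
       distr_support (fourier_distr f) \<subseteq> {-1..1} \<times> {-1..1} \<Longrightarrow>
       selfadjoint A1 \<Longrightarrow> finite_rank A1 \<Longrightarrow> selfadjoint A2 \<Longrightarrow> finite_rank A2 \<Longrightarrow>
       selfadjoint B1 \<Longrightarrow> finite_rank B1 \<Longrightarrow> selfadjoint B2 \<Longrightarrow> finite_rank B2 \<Longrightarrow>
       norm (op_fun f A1 B1 - op_fun f A2 B2) \<le> M * Linf_norm f * (norm (A1 - A2) + norm (B1 - B2))"
    by blast
  define K where "K = M * fejer_bound\<^sup>2 * (2 * pi)"
  have key: "sqrt n \<le> K" if n: "n > 0" for n :: nat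
  proof -
    obtain e :: "nat \<Rightarrow> 'a" where e: "orthonormal n e"
      using orthonormal_exists[OF assms] by blast
    note h = orthonormal_fourier_basis[OF e]
    define a where "a = (\<lambda>i k. cnj (dft n i k))"
    define f where "f = interpolant n a"
    define A1 where "A1 = diag_op n e node"
    define A2 where "A2 = diag_op n e (\<lambda>i. node i + 2 * pi)"
    define B where "B = diag_op n (fourier_basis n e) node"
    have a: "cmod (a i k) \<le> 1" for i k
      by (simp add: a_def)
    have f0: "f (0, t) = 0" "f (t, 0) = 0" for t
      unfolding f_def by (rule interpolant_eq_0[OF fejer_node_zero])+
    have ne: "node i \<noteq> 0" "node i + 2 * pi \<noteq> 0" for i
      using node_pos[of i] pi_gt_zero by linarith+
    have inj: "inj_on (\<lambda>i. node i + 2 * pi) {..<n}"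
      using inj_node[of "{..<n}"] by (simp add: inj_on_def)
    have "op_fun f A1 B = (\<Sum>i<n. \<Sum>k<n. scaleC_op (cnj (dft n i k))
        (line_proj (e i) o\<^sub>L line_proj (fourier_basis n e k)))"
      unfolding A1_def B_def
        op_fun_diag_op[where f = f and l = node and k = node, OF e inj_node ne(1) h inj_node ne(1) f0]
      by (intro sum.cong) (simp_all add: f_def interpolant_node a_def)
    then have large: "sqrt n \<le> norm (op_fun f A1 B)"
      using schur_multiplier_lower_bound[OF e n] by simp
    have "f (node i + 2 * pi, t) = 0" for i t
      unfolding f_def by (rule interpolant_eq_0(1)[OF fejer_shifted_node])
    then have null: "op_fun f A2 B = 0"
      unfolding A2_def B_def
        op_fun_diag_op[where f = f and l = "\<lambda>i. node i + 2 * pi" and k = node, OF e inj ne(2) h inj_node ne(1) f0] by simp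
    have "A1 - A2 = diag_op n e (\<lambda>_. - 2 * pi)"
      by (simp add: A1_def A2_def diag_op_def flip: sum_subtractf scaleR_diff_left)
    then have close: "norm (A1 - A2) \<le> 2 * pi"
      using norm_diag_op_const[OF e, of "- 2 * pi"] by simp
    have "norm (op_fun f A1 B - op_fun f A2 B) \<le> M * Linf_norm f * (norm (A1 - A2) + norm (B - B))"
    proof (rule lipschitz)
      show "bounded (range f)"
        unfolding f_def by (rule boundedI) (auto intro!: interpolant_bound a)
    qed (simp_all add: f_def A1_def A2_def B_def smooth_interpolant distr_support_interpolant
        selfadjoint_diag_op finite_rank_diag_op)
    also have "\<dots> \<le> M * fejer_bound\<^sup>2 * norm (A1 - A2)"
      using M Linf_norm_interpolant[OF a, of n] by (simp add: f_def mult_right_mono)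
    also have "\<dots> \<le> K"
      unfolding K_def using M close by (intro mult_left_mono) auto
    finally show ?thesis
      using large null by simp
  qed
  obtain N where N: "K\<^sup>2 < real N"
    using reals_Archimedean2 by blast
  then have "N > 0"
    using zero_le_power2[of K] by (cases N) auto
  then have "(sqrt N)\<^sup>2 \<le> K\<^sup>2"
    by (intro power_mono key) auto
  with N show False by simp
qed

end
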